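(* Let $\mathcal{C}$ be a basis of some vector space $W$ over a field $K$, and let $\prec$ be a total order on $\mathcal{C}$. Then the OSBB-words over $\mathcal{C}$ form a basis of the free tensor algebra $T(W)=\bigoplus_{i\ge 0}W^{\otimes i}$.
   Context: The tensor product of elements of $T(W)$ is written $x\cdot y$, and $[x,y]=x\cdot y-y\cdot x$. For $x_1,\dots,x_k\in\mathcal{C}$, the symmetrization map is $\mathfrak{s}(x_1\cdots x_k)=\frac1{k!}\sum_{\sigma\in S_k}\sigma(x_1\cdots x_k)$, where the symmetric group $S_k$ acts by permuting the letters of words of length $k$. - A symmetric word is an element $\mathfrak{s}(x_1\cdots x_k)$ with $k\ge0$, $x_i\in\mathcal{C}$ (the empty word is a symmetric word). - A symmetric-bracket word is an element $\mathfrak{s}(x_1\cdots x_k)\cdot[y,z]$ with $k\ge 0$, $x_i,y,z\in\mathcal{C}$. It is ordered (an OSB-word) if $z\prec y$ and $z\preceq x_i$ for all $i$. - An OSBB-word (ordered symmetric-bracket-block word) is an element $\omega_1\cdots\omega_s$ ($s\ge1$) where $\omega_i$ is an OSB-word for $1\le i<s$ and $\omega_s$ is a (possibly empty) symmetric word.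
   Formalization: The field K is taken of characteristic 0, because the symmetrization map has the factor 1/k!, which is undefined in positive characteristic p as soon as k is at least p. *)

theory Defs
  imports
    "HOL-Library.Poly_Mapping"
    "HOL-Combinatorics.Permutations"
    "HOL-Combinatorics.List_Permutation"
    "HOL-Algebra.QuotRing"
    "HOL-Algebra.Module"
    "HOL-Algebra.Algebraic_Closure_Type"
begin

text \<open>
  Lists form the free monoid under concatenation, so the convolution product of
  \<^theory>\<open>HOL-Library.Poly_Mapping\<close> makes finitely supported functions on lists a ring.
\<close>

instantiation list :: (type) monoid_add
begin

definition zero_list :: "'a list" where "zero_list = []"

definition plus_list :: "'a list \<Rightarrow> 'a list \<Rightarrow> 'a list" where "plus_list = (@)"

instance by standard (simp_all add: zero_list_def plus_list_def)

end


section \<open>The tensor algebra of a vector space\<close>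

text \<open>
  \<open>Poly_Mapping.single [w\<^sub>1, \<dots>, w\<^sub>k] a\<close> is the formal multiple of the word \<open>w\<^sub>1 \<dots> w\<^sub>k\<close> of
  arbitrary vectors of \<open>W\<close>.  The tensor power of degree \<open>k\<close> is the space of formal combinations of
  words of length \<open>k\<close> modulo multilinearity.  The relations below are homogeneous in the
  length, so factoring all of them out of the formal combinations of words of any length
  yields the direct sum of the tensor powers, with concatenation as product.
\<close>

abbreviation formal_words :: "('w list \<Rightarrow>\<^sub>0 'k::field) ring" where
  "formal_words \<equiv> ring_of_type_algebra"

definition formal_scale :: "'k::field \<Rightarrow> ('w list \<Rightarrow>\<^sub>0 'k) \<Rightarrow> ('w list \<Rightarrow>\<^sub>0 'k)" where
  "formal_scale a p = Poly_Mapping.map ((*) a) p"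

definition multilinear_relations ::
    "('k::field \<Rightarrow> 'w::ab_group_add \<Rightarrow> 'w) \<Rightarrow> ('w list \<Rightarrow>\<^sub>0 'k) set" where
  "multilinear_relations scale =
     {Poly_Mapping.single (u @ [x + y] @ v) 1
        - Poly_Mapping.single (u @ [x] @ v) 1 - Poly_Mapping.single (u @ [y] @ v) 1 | u v x y. True}
   \<union> {Poly_Mapping.single (u @ [scale a x] @ v) 1
        - formal_scale a (Poly_Mapping.single (u @ [x] @ v) 1) | u v a x. True}"

definition tensor_kernel ::
    "('k::field \<Rightarrow> 'w::ab_group_add \<Rightarrow> 'w) \<Rightarrow> ('w list \<Rightarrow>\<^sub>0 'k) set" where
  "tensor_kernel scale = module.span formal_scale (multilinear_relations scale)"

definition tensor_class ::
    "('k::field \<Rightarrow> 'w::ab_group_add \<Rightarrow> 'w) \<Rightarrow> ('w list \<Rightarrow>\<^sub>0 'k) \<Rightarrow> ('w list \<Rightarrow>\<^sub>0 'k) set" where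
  "tensor_class scale p = tensor_kernel scale +>\<^bsub>formal_words\<^esub> p"

text \<open>
  The elements are cosets, so in the scalar multiplication \<open>a \<odot> t\<close> the kernel is added again:
  for \<open>a = 0\<close> the set of multiples alone would not be a coset.
\<close>

definition tensor_algebra ::
    "('k::field \<Rightarrow> 'w::ab_group_add \<Rightarrow> 'w) \<Rightarrow> ('k, ('w list \<Rightarrow>\<^sub>0 'k) set) module" where
  "tensor_algebra scale =
     ring.extend (formal_words Quot tensor_kernel scale)
       (module.fields (\<lambda>a t. \<Union>p\<in>t. tensor_class scale (formal_scale a p)))"

definition tensor_word ::
    "('k::field \<Rightarrow> 'w::ab_group_add \<Rightarrow> 'w) \<Rightarrow> 'w list \<Rightarrow> ('w list \<Rightarrow>\<^sub>0 'k) set" where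
  "tensor_word scale xs = tensor_class scale (Poly_Mapping.single xs 1)"


subsection \<open>The quotient is a ring and a module over the field\<close>

lemma formal_words_ring: "ring (formal_words :: ('w list \<Rightarrow>\<^sub>0 'k::field) ring)"
proof -
  have "\<exists>y. x + y = 0" for x :: "'w list \<Rightarrow>\<^sub>0 'k"
    using add.right_inverse by blast
  then show ?thesis
    unfolding ring_of_type_algebra_def using add.right_inverse
    by unfold_locales (auto simp: algebra_simps Units_def)
qed

lemma formal_scale_single: "formal_scale a (Poly_Mapping.single u b) = Poly_Mapping.single u (a * b)"
  unfolding formal_scale_def by (rule poly_mapping_eqI) (simp add: lookup_single when_def)

lemma lookup_formal_scale: "Poly_Mapping.lookup (formal_scale a p) u = a * Poly_Mapping.lookup p u"
  unfolding formal_scale_def by (simp add: Poly_Mapping.map.rep_eq when_def)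

lemma formal_scale_vector_space: "vector_space formal_scale"
  by unfold_locales
     (auto intro!: poly_mapping_eqI simp: lookup_formal_scale lookup_add algebra_simps)

lemma formal_induct:
  assumes "\<And>u a. P (Poly_Mapping.single u a)" "\<And>p q. P p \<Longrightarrow> P q \<Longrightarrow> P (p + q)"
  shows "P (p :: 'a \<Rightarrow>\<^sub>0 'k::comm_monoid_add)"
proof -
  have "P (\<Sum>u\<in>A. Poly_Mapping.single u (f u))" if "finite A" for A and f :: "'a \<Rightarrow> 'k"
    using that
  proof induction
    case empty
    then show ?case using assms(1)[of _ 0] by simp
  qed (use assms in auto)
  moreover have "(\<Sum>u\<in>Poly_Mapping.keys p. Poly_Mapping.single u (Poly_Mapping.lookup p u)) = p"
    by (rule poly_mapping_eqI)
       (auto simp: lookup_sum lookup_single when_def in_keys_iff sum.If_cases Int_def)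
  ultimately show ?thesis by (metis finite_keys)
qed

lemma formal_scale_mult: "formal_scale a p = Poly_Mapping.single 0 a * p"
proof (induction p rule: formal_induct)
  case (1 u b) then show ?case by (simp add: formal_scale_single mult_single)
next
  case (2 f g)
  interpret vector_space formal_scale by (rule formal_scale_vector_space)
  show ?case using 2 by (simp add: scale_right_distrib distrib_left)
qed

lemma single0_central: "Poly_Mapping.single (0::'w list) a * p = p * Poly_Mapping.single 0 (a::'k::field)"
proof (induction p rule: formal_induct)
  case (1 u b) then show ?case by (simp add: mult_single mult.commute)
next
  case (2 f g)
  then show ?case by (simp add: distrib_left distrib_right)
qed

lemma rel_word_mult:
  assumes "p \<in> multilinear_relations scale"
  shows "Poly_Mapping.single u 1 * p \<in> multilinear_relations scale"
    "p * Poly_Mapping.single u 1 \<in> multilinear_relations scale"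
proof -
  consider (a) u' v x y where "p = Poly_Mapping.single (u' @ [x + y] @ v) 1
        - Poly_Mapping.single (u' @ [x] @ v) 1 - Poly_Mapping.single (u' @ [y] @ v) 1"
    | (b) u' v a x where "p = Poly_Mapping.single (u' @ [scale a x] @ v) 1
        - formal_scale a (Poly_Mapping.single (u' @ [x] @ v) 1)"
    using assms unfolding multilinear_relations_def by auto
  then have "Poly_Mapping.single u 1 * p \<in> multilinear_relations scale
     \<and> p * Poly_Mapping.single u 1 \<in> multilinear_relations scale"
  proof cases
    case a
    have "Poly_Mapping.single u 1 * p = Poly_Mapping.single ((u @ u') @ [x + y] @ v) 1
        - Poly_Mapping.single ((u @ u') @ [x] @ v) 1 - Poly_Mapping.single ((u @ u') @ [y] @ v) 1"
     "p * Poly_Mapping.single u 1 = Poly_Mapping.single (u' @ [x + y] @ (v @ u)) 1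
        - Poly_Mapping.single (u' @ [x] @ (v @ u)) 1 - Poly_Mapping.single (u' @ [y] @ (v @ u)) 1"
      by (simp_all add: a algebra_simps mult_single plus_list_def)
    then show ?thesis unfolding multilinear_relations_def by blast
  next
    case b
    have "Poly_Mapping.single u 1 * p = Poly_Mapping.single ((u @ u') @ [scale a x] @ v) 1
        - formal_scale a (Poly_Mapping.single ((u @ u') @ [x] @ v) 1)"
     "p * Poly_Mapping.single u 1 = Poly_Mapping.single (u' @ [scale a x] @ (v @ u)) 1
        - formal_scale a (Poly_Mapping.single (u' @ [x] @ (v @ u)) 1)"
      by (simp_all add: b algebra_simps mult_single plus_list_def formal_scale_single)
    then show ?thesis unfolding multilinear_relations_def by blast
  qed
  then show "Poly_Mapping.single u 1 * p \<in> multilinear_relations scale"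
    "p * Poly_Mapping.single u 1 \<in> multilinear_relations scale" by auto
qed

lemma tensor_kernel_subspace: "module.subspace formal_scale (tensor_kernel scale)"
proof -
  interpret vector_space formal_scale by (rule formal_scale_vector_space)
  show ?thesis unfolding tensor_kernel_def by (rule subspace_span)
qed

lemma tensor_kernel_mult:
  assumes p: "p \<in> tensor_kernel scale"
  shows "q * p \<in> tensor_kernel scale \<and> p * q \<in> tensor_kernel scale"
proof -
  interpret vector_space formal_scale by (rule formal_scale_vector_space)
  have S: "subspace (tensor_kernel scale)" by (rule tensor_kernel_subspace)
  have *: "Poly_Mapping.single u b * p \<in> tensor_kernel scale \<and>
    p * Poly_Mapping.single u b \<in> tensor_kernel scale" for u b
    using p unfolding tensor_kernel_def
  proof (induction rule: span_induct_alt)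
    case base
    then show ?case by (simp add: span_zero)
  next
    case (step c x y)
    let ?s = "\<lambda>b. Poly_Mapping.single u b"
    have 1: "?s b = formal_scale b (?s 1)" by (simp add: formal_scale_single)
    have m: "formal_scale c x * q = formal_scale c (x * q)" 
        "q * formal_scale c x = formal_scale c (q * x)" for c x q
      by (simp_all add: formal_scale_mult mult.assoc single0_central)
    have "?s b * formal_scale c x = formal_scale b (formal_scale c (?s 1 * x))"
      "formal_scale c x * ?s b = formal_scale b (formal_scale c (x * ?s 1))"
      by (subst 1, simp only: m scale_scale mult.commute)+
    then show ?case using step rel_word_mult[of x scale u]
      by (auto simp: distrib_left distrib_right intro!: span_add[OF span_scale[OF span_base]])
  qed
  show ?thesis
  proof (induction q rule: formal_induct)
    case (1 u b) then show ?case by (rule *)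
  next
    case (2 f g)
    then show ?case using subspace_add[OF S] by (simp add: distrib_left distrib_right)
  qed
qed

lemma formal_words_simps [simp]:
  "carrier formal_words = UNIV" "x \<otimes>\<^bsub>formal_words\<^esub> y = x * y" "x \<oplus>\<^bsub>formal_words\<^esub> y = x + y"
  "\<one>\<^bsub>formal_words\<^esub> = 1" "\<zero>\<^bsub>formal_words\<^esub> = 0"
  by (simp_all add: ring_of_type_algebra_def)

lemma formal_words_minus [simp]: "\<ominus>\<^bsub>formal_words\<^esub> x = - x"
proof -
  interpret ring formal_words by (rule formal_words_ring)
  show ?thesis using minus_equality[of "-x" x] by simp
qed

lemma tensor_kernel_ideal:
  fixes scale :: "'a::field \<Rightarrow> 'b::ab_group_add \<Rightarrow> 'b"
  shows "ideal (tensor_kernel scale) formal_words"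
proof (rule idealI)
  interpret vector_space formal_scale by (rule formal_scale_vector_space)
  show "ring (formal_words :: ('b list \<Rightarrow>\<^sub>0 'a) ring)" by (rule formal_words_ring)
  have S: "subspace (tensor_kernel scale)" by (rule tensor_kernel_subspace)
  interpret R: ring "formal_words :: ('b list \<Rightarrow>\<^sub>0 'a) ring" by (rule formal_words_ring)
  show "subgroup (tensor_kernel scale) (add_monoid formal_words)"
  proof (rule R.add.subgroupI)
    show "tensor_kernel scale \<noteq> {}" using subspace_0[OF S] by auto
  next
    fix a assume "a \<in> tensor_kernel scale"
    then show "\<ominus>\<^bsub>formal_words\<^esub> a \<in> tensor_kernel scale"
      using subspace_neg[OF S] by simp
  qed (use subspace_add[OF S] in auto)
qed (use tensor_kernel_mult in auto)

lemma tensor_algebra_simps [simp]: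
  "carrier (tensor_algebra scale) = carrier (formal_words Quot tensor_kernel scale)"
  "monoid.mult (tensor_algebra scale) = monoid.mult (formal_words Quot tensor_kernel scale)"
  "add (tensor_algebra scale) = add (formal_words Quot tensor_kernel scale)"
  "\<one>\<^bsub>tensor_algebra scale\<^esub> = \<one>\<^bsub>formal_words Quot tensor_kernel scale\<^esub>"
  "\<zero>\<^bsub>tensor_algebra scale\<^esub> = \<zero>\<^bsub>formal_words Quot tensor_kernel scale\<^esub>"
  "a \<odot>\<^bsub>tensor_algebra scale\<^esub> t =
     (\<Union>p\<in>t. tensor_class scale (formal_scale a p))"
  by (simp_all add: tensor_algebra_def ring.defs module.defs)

lemma tensor_algebra_ring: "ring (tensor_algebra scale)"
proof -
  interpret Q: ring "formal_words Quot tensor_kernel scale"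
    by (rule ideal.quotient_is_ring[OF tensor_kernel_ideal])
  show ?thesis
    by (rule ringI; (rule abelian_groupI monoidI)?)
       (auto simp: Q.a_ac Q.m_assoc Q.l_distr Q.r_distr intro: Q.add.l_inv_ex)
qed

lemma tensor_class_eq: "tensor_class scale p = {n + p | n. n \<in> tensor_kernel scale}"
  by (auto simp: tensor_class_def a_r_coset_def r_coset_def ring_of_type_algebra_def)

lemma tensor_class_carrier: "carrier (tensor_algebra scale) = range (tensor_class scale)"
  by (auto simp: tensor_class_def FactRing_def A_RCOSETS_def' )

lemma tensor_class_smult: "a \<odot>\<^bsub>tensor_algebra scale\<^esub> tensor_class scale p = tensor_class scale (formal_scale a p)"
proof -
  interpret vector_space formal_scale by (rule formal_scale_vector_space)
  have S: "subspace (tensor_kernel scale)" by (rule tensor_kernel_subspace)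
  have "(\<Union>q\<in>tensor_class scale p. tensor_class scale (formal_scale a q)) = tensor_class scale (formal_scale a p)"
    apply (auto simp: tensor_class_eq scale_right_distrib)
     apply (metis (no_types, lifting) S add.assoc subspace_add subspace_scale)
    apply (metis S add.left_neutral scale_zero_right subspace_0)
    done
  then show ?thesis by simp
qed

lemma tensor_class_add: "tensor_class scale p \<oplus>\<^bsub>tensor_algebra scale\<^esub> tensor_class scale q = tensor_class scale (p + q)"
proof -
  interpret I: ideal "tensor_kernel scale" formal_words by (rule tensor_kernel_ideal)
  show ?thesis by (simp add: tensor_class_def FactRing_def I.a_rcos_sum)
qed

lemma tensor_algebra_module: "module ring_of_type_algebra (tensor_algebra scale)"
proof -
  interpret vector_space formal_scale by (rule formal_scale_vector_space)
  interpret T: ring "tensor_algebra scale" by (rule tensor_algebra_ring)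
  show ?thesis
    apply (rule moduleI)
          apply (rule cring_from_type_algebra)
         apply (rule T.abelian_group_axioms)
        apply (simp_all only: tensor_class_carrier)
        apply (auto simp: ring_of_type_algebra_def tensor_class_add tensor_class_smult scale_left_distrib scale_right_distrib
           simp del: tensor_algebra_simps)
    done
qed

lemma tensor_class_mult: "tensor_class scale p \<otimes>\<^bsub>tensor_algebra scale\<^esub> tensor_class scale q = tensor_class scale (p * q)"
proof -
  interpret I: ideal "tensor_kernel scale" formal_words by (rule tensor_kernel_ideal)
  show ?thesis using I.rcoset_mult_add[of p q] by (simp add: tensor_class_def FactRing_def)
qed

lemma tensor_word_append:
  "tensor_word scale (xs @ ys) = tensor_word scale xs \<otimes>\<^bsub>tensor_algebra scale\<^esub> tensor_word scale ys"
  using tensor_class_mult[of scale "Poly_Mapping.single xs 1" "Poly_Mapping.single ys 1"]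
  by (simp add: tensor_word_def mult_single plus_list_def del: tensor_algebra_simps)

lemmas [simp del] = tensor_algebra_simps


section \<open>Bases\<close>

text \<open>
  The library notions of independence and span are for whole types, whereas
  the carrier of \<^const>\<open>tensor_algebra\<close> is a set of cosets.
\<close>

definition lin_independent :: "('k::field, 'm, 'z) module_scheme \<Rightarrow> 'm set \<Rightarrow> bool" where
  "lin_independent M B \<longleftrightarrow>
     (\<forall>A c. finite A \<and> A \<subseteq> B \<and> (\<Oplus>\<^bsub>M\<^esub>b\<in>A. c b \<odot>\<^bsub>M\<^esub> b) = \<zero>\<^bsub>M\<^esub> \<longrightarrow> (\<forall>b\<in>A. c b = 0))"

definition lin_span :: "('k::field, 'm, 'z) module_scheme \<Rightarrow> 'm set \<Rightarrow> 'm set" where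
  "lin_span M B = {\<Oplus>\<^bsub>M\<^esub>b\<in>A. c b \<odot>\<^bsub>M\<^esub> b | A c. finite A \<and> A \<subseteq> B}"

definition is_basis :: "('k::field, 'm, 'z) module_scheme \<Rightarrow> 'm set \<Rightarrow> bool" where
  "is_basis M B \<longleftrightarrow> B \<subseteq> carrier M \<and> lin_independent M B \<and> lin_span M B = carrier M"


section \<open>Ordered symmetric-bracket-block words\<close>

text \<open>The factor \<open>1 / k!\<close> only makes sense in characteristic zero.\<close>

definition symmetrization ::
    "('k::field_char_0 \<Rightarrow> 'w::ab_group_add \<Rightarrow> 'w) \<Rightarrow> 'w list \<Rightarrow> ('w list \<Rightarrow>\<^sub>0 'k) set" where
  "symmetrization scale xs =
     (1 / fact (length xs)) \<odot>\<^bsub>tensor_algebra scale\<^esub>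
       (\<Oplus>\<^bsub>tensor_algebra scale\<^esub>\<sigma>\<in>{\<sigma>. \<sigma> permutes {..<length xs}}.
          tensor_word scale (permute_list \<sigma> xs))"

definition bracket :: "('a, 'm) ring_scheme \<Rightarrow> 'a \<Rightarrow> 'a \<Rightarrow> 'a" where
  "bracket R x y = x \<otimes>\<^bsub>R\<^esub> y \<ominus>\<^bsub>R\<^esub> y \<otimes>\<^bsub>R\<^esub> x"

definition symmetric_words ::
    "('k::field_char_0 \<Rightarrow> 'w::ab_group_add \<Rightarrow> 'w) \<Rightarrow> 'w set \<Rightarrow> ('w list \<Rightarrow>\<^sub>0 'k) set set" where
  "symmetric_words scale C = {symmetrization scale xs | xs. set xs \<subseteq> C}"

definition symmetric_bracket_word ::
    "('k::field_char_0 \<Rightarrow> 'w::ab_group_add \<Rightarrow> 'w) \<Rightarrow> 'w list \<Rightarrow> 'w \<Rightarrow> 'w \<Rightarrow> ('w list \<Rightarrow>\<^sub>0 'k) set"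
  where
  "symmetric_bracket_word scale xs y z =
     symmetrization scale xs \<otimes>\<^bsub>tensor_algebra scale\<^esub>
       bracket (tensor_algebra scale) (tensor_word scale [y]) (tensor_word scale [z])"

text \<open>The relation \<open>r\<close> is the reflexive order: \<open>(z, x) \<in> r\<close> means \<open>z \<preceq> x\<close>.\<close>

definition OSB_words ::
    "('k::field_char_0 \<Rightarrow> 'w::ab_group_add \<Rightarrow> 'w) \<Rightarrow> 'w set \<Rightarrow> 'w rel \<Rightarrow> ('w list \<Rightarrow>\<^sub>0 'k) set set"
  where
  "OSB_words scale C r =
     {symmetric_bracket_word scale xs y z | xs y z.
        set xs \<subseteq> C \<and> y \<in> C \<and> z \<in> C \<and> (z, y) \<in> r \<and> z \<noteq> y \<and> (\<forall>x\<in>set xs. (z, x) \<in> r)}"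

definition OSBB_words ::
    "('k::field_char_0 \<Rightarrow> 'w::ab_group_add \<Rightarrow> 'w) \<Rightarrow> 'w set \<Rightarrow> 'w rel \<Rightarrow> ('w list \<Rightarrow>\<^sub>0 'k) set set"
  where
  "OSBB_words scale C r =
     {foldr (\<otimes>\<^bsub>tensor_algebra scale\<^esub>) ws v | ws v.
        set ws \<subseteq> OSB_words scale C r \<and> v \<in> symmetric_words scale C}"

end

theory Submission
  imports Defs
begin

text \<open>
  In the free algebra on \<open>C\<close> let \<open>f c = s(M - c) \<cdot> c\<close> for a letter \<open>c\<close> of a multiset \<open>M\<close> with
  minimum \<open>z\<close>. Modulo OSB-words of degree less than \<open>\<bar>M\<bar>\<close> times words, \<open>s(M - c - z) \<cdot> [c, z]\<close>
  equals \<open>f z - f c\<close>. As \<open>s(M)\<close> is the average of all \<open>f d\<close>, each \<open>f c - s(M)\<close> is a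
  combination of OSB-words times words. Hence the OSBB-words with a given multiset of letters span
  all words with these letters. Independence is a count: a word is parsed into
  decreasing runs, each followed by an ascent, and this yields every OSBB-word, so there are at most
  as many OSBB-words as words. The tensor algebra is identified with the free algebra by a linear
  retraction of the formal words on all vectors which kills the multilinear relations.
\<close>

interpretation formal: vector_space "formal_scale :: 'k::field \<Rightarrow> ('a list \<Rightarrow>\<^sub>0 'k) \<Rightarrow> _"
  by (rule formal_scale_vector_space)

section \<open>Words and homogeneous elements\<close>

abbreviation word :: "'a list \<Rightarrow> ('a list \<Rightarrow>\<^sub>0 'k::field)" where
  "word u \<equiv> Poly_Mapping.single u 1"

lemma word_mult: "word u * word v = (word (u @ v) :: 'a list \<Rightarrow>\<^sub>0 'k::field)"
  by (simp add: mult_single plus_list_def)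

lemma word_Nil: "word [] = (1 :: 'a list \<Rightarrow>\<^sub>0 'k::field)"
  by (simp flip: zero_list_def)

lemma formal_scale_mult_left: "formal_scale a p * q = formal_scale a (p * q)"
  by (simp add: formal_scale_mult mult.assoc)

lemma formal_scale_mult_right: "p * formal_scale a q = formal_scale a (p * q)"
  by (simp add: formal_scale_mult single0_central mult.assoc)

lemma inj_word: "inj (word :: 'a list \<Rightarrow> ('a list \<Rightarrow>\<^sub>0 'k::field))"
proof (rule injI)
  fix u v :: "'a list"
  assume "word u = (word v :: 'a list \<Rightarrow>\<^sub>0 'k)"
  from arg_cong[OF this, of "\<lambda>p. Poly_Mapping.lookup p u"] show "u = v"
    by (simp add: lookup_single when_def split: if_splits)
qed

text \<open>The coefficient of a vanishing combination at \<open>u\<close> is exactly the scalar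
  attached to \<open>word u\<close>.\<close>

lemma independent_words: "formal.independent (range (word :: 'a list \<Rightarrow> ('a list \<Rightarrow>\<^sub>0 'k::field)))"
  unfolding formal.independent_explicit_finite_subsets
proof (intro allI impI ballI)
  fix S :: "('a list \<Rightarrow>\<^sub>0 'k) set" and c v
  assume S: "S \<subseteq> range word" "finite S" and 0: "(\<Sum>v\<in>S. formal_scale (c v) v) = 0" and v: "v \<in> S"
  obtain u where u: "v = word u" using S v by auto
  have "Poly_Mapping.lookup w u = (if w = v then 1 else 0)" if "w \<in> S" for w
    using S that by (auto simp: u lookup_single when_def dest: injD[OF inj_word])
  then have "Poly_Mapping.lookup (\<Sum>v\<in>S. formal_scale (c v) v) u = (\<Sum>w\<in>S. if w = v then c w else 0)"
    by (auto simp: lookup_sum lookup_formal_scale intro!: sum.cong)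
  also have "\<dots> = c v" using S v by simp
  finally show "c v = 0" by (simp add: 0)
qed

text \<open>By bilinearity of the product, membership need only be tested on generators.\<close>

lemma span_mult_mem:
  assumes p: "p \<in> formal.span S" and q: "q \<in> formal.span T"
    and ST: "\<And>x y. x \<in> S \<Longrightarrow> y \<in> T \<Longrightarrow> x * y \<in> formal.span U"
  shows "p * q \<in> formal.span U"
proof -
  have "x * q \<in> formal.span U" if "x \<in> S" for x
    using q
    by (induction rule: formal.span_induct_alt)
       (auto simp: distrib_left formal_scale_mult_right that
          intro!: formal.span_add formal.span_scale formal.span_zero ST)
  with p show ?thesis
    by (induction rule: formal.span_induct_alt)
       (auto simp: distrib_right formal_scale_mult_left
          intro!: formal.span_add formal.span_scale formal.span_zero)
qed

text \<open>The grading by multisets of letters refines the one by length. It keeps track of which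
  letters remain when a factor is split off.\<close>

definition homogeneous :: "'a multiset \<Rightarrow> ('a list \<Rightarrow>\<^sub>0 'k::field) set" where
  "homogeneous M = formal.span (word ` {w. mset w = M})"

lemma word_homogeneous: "word w \<in> homogeneous (mset w)"
  unfolding homogeneous_def by (rule formal.span_base) simp

lemma homogeneous_mult:
  assumes "p \<in> homogeneous M" "q \<in> homogeneous N"
  shows "p * q \<in> homogeneous (M + N)"
  using assms unfolding homogeneous_def
  by (rule span_mult_mem) (auto simp: word_mult intro!: formal.span_base)


section \<open>Symmetrization\<close>

definition sym_list :: "'a list \<Rightarrow> ('a list \<Rightarrow>\<^sub>0 'k::field_char_0)" where
  "sym_list xs = formal_scale (1 / fact (length xs))
     (\<Sum>\<sigma> | \<sigma> permutes {..<length xs}. word (permute_list \<sigma> xs))"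

text \<open>The chosen listing is immaterial by \<open>sym_list_cong\<close>. Indexing by multisets
  lets a letter be removed without choosing a position.\<close>

definition symmetrize :: "'a multiset \<Rightarrow> ('a list \<Rightarrow>\<^sub>0 'k::field_char_0)" where
  "symmetrize M = sym_list (SOME xs. mset xs = M)"

text \<open>Left composition with a permutation that turns \<open>ys\<close> into \<open>xs\<close>
  merely reorders the sum over all permutations.\<close>

lemma sym_list_cong:
  assumes "mset xs = mset ys"
  shows "sym_list xs = sym_list ys"
proof -
  obtain p where p: "p permutes {..<length ys}" "permute_list p ys = xs"
    using mset_eq_permutation[OF assms] .
  have "(\<Sum>\<sigma> | \<sigma> permutes {..<length ys}. word (permute_list \<sigma> (permute_list p ys)))
      = (\<Sum>\<sigma> | \<sigma> permutes {..<length ys}. word (permute_list (p \<circ> \<sigma>) ys) :: 'a list \<Rightarrow>\<^sub>0 'b)"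
    by (rule sum.cong) (auto simp: permute_list_compose)
  also have "\<dots> = (\<Sum>\<sigma> | \<sigma> permutes {..<length ys}. word (permute_list \<sigma> ys))"
    by (rule setum_permutations_compose_left[OF p(1), symmetric])
  finally show ?thesis using p by (auto simp: sym_list_def)
qed

lemma symmetrize_mset [simp]: "symmetrize (mset xs) = sym_list xs"
  unfolding symmetrize_def by (rule sym_list_cong) (rule someI, rule refl)

lemma symmetrize_homogeneous: "symmetrize M \<in> homogeneous M"
proof -
  obtain xs where M: "M = mset xs" by (metis ex_mset)
  show ?thesis
    unfolding M symmetrize_mset sym_list_def homogeneous_def
    by (intro formal.span_scale formal.span_sum formal.span_base) auto
qed

text \<open>The permuted words are sorted by the position \<open>b\<close> whose letter comes last.
  Each permutation of \<open>Suc n\<close> points is uniquely \<open>transpose n b \<circ> q\<close>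
  with \<open>q\<close> fixing \<open>n\<close>, and it sends \<open>n\<close> to
  \<open>b\<close>.\<close>

lemma sym_list_recurrence:
  assumes n: "length xs = Suc n"
  shows "formal_scale (of_nat (Suc n)) (sym_list xs)
    = (\<Sum>b\<le>n. symmetrize (mset xs - {#xs ! b#}) * (word [xs ! b] :: 'a list \<Rightarrow>\<^sub>0 'k::field_char_0))"
proof -
  \<comment> \<open>One copy of \<open>xs ! b\<close> is removed by moving the last letter into its
    place. This is the arrangement that the transposition produces on the first \<open>n\<close>
    positions; for \<open>b = n\<close> the last letter is just dropped.\<close>
  define ys where "ys b = butlast (xs[b := xs ! n])" for b
  have len: "length (ys b) = n" for b by (simp add: ys_def n)
  have ms: "mset (ys b) = mset xs - {#xs ! b#}" if "b \<le> n" for b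
  proof -
    have ne: "xs[b := xs ! n] \<noteq> []" using n by auto
    have l: "last (xs[b := xs ! n]) = xs ! n"
      using n that by (subst last_conv_nth[OF ne]) (auto simp: nth_list_update)
    have "mset (ys b) = mset (xs[b := xs ! n]) - {#xs ! n#}"
      using append_butlast_last_id[OF ne] unfolding ys_def l
      by (metis add_diff_cancel_right' mset.simps(1) mset.simps(2) mset_append)
    also have "\<dots> = mset xs - {#xs ! b#}"
      using n that by (simp add: mset_update)
    finally show ?thesis .
  qed
  have perm: "permute_list (transpose n b \<circ> q) xs = permute_list q (ys b) @ [xs ! b]"
    if b: "b \<le> n" and q: "q permutes {..<n}" for b q
  proof -
    have "xs ! transpose n b (q i) = ys b ! q i" if "i < n" for i
      using permutes_in_image[OF q, of i] that b n
      by (auto simp: ys_def nth_butlast transpose_def nth_list_update)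
    moreover have "q n = n" using q by (simp add: permutes_not_in)
    ultimately show ?thesis
      by (simp add: permute_list_def n len)
  qed
  have "(\<Sum>\<sigma> | \<sigma> permutes {..<Suc n}. word (permute_list \<sigma> xs))
     = (\<Sum>b\<le>n. \<Sum>q | q permutes {..<n}. word (permute_list (transpose n b \<circ> q) xs) :: 'a list \<Rightarrow>\<^sub>0 'k)"
    unfolding lessThan_Suc by (subst sum_over_permutations_insert)
      (auto simp flip: lessThan_Suc lessThan_Suc_atMost)
  also have "\<dots> = (\<Sum>b\<le>n. formal_scale (fact n) (sym_list (ys b)) * word [xs ! b])"
    by (intro sum.cong) (auto simp: perm sym_list_def len sum_distrib_right word_mult)
  also have "\<dots> = formal_scale (fact n) (\<Sum>b\<le>n. symmetrize (mset xs - {#xs ! b#}) * word [xs ! b])"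
    by (auto simp: formal.scale_sum_right formal_scale_mult_left simp flip: ms intro!: sum.cong)
  finally have "(\<Sum>\<sigma> | \<sigma> permutes {..<Suc n}. word (permute_list \<sigma> xs))
     = formal_scale (fact n) (\<Sum>b\<le>n. symmetrize (mset xs - {#xs ! b#}) * (word [xs ! b] :: 'a list \<Rightarrow>\<^sub>0 'k))" .
  then have "formal_scale (of_nat (Suc n)) (sym_list xs) = formal_scale (of_nat (Suc n) / fact (Suc n) * fact n)
      (\<Sum>b\<le>n. symmetrize (mset xs - {#xs ! b#}) * (word [xs ! b] :: 'a list \<Rightarrow>\<^sub>0 'k))"
    unfolding sym_list_def n by (simp del: of_nat_Suc fact_Suc)
  also have "of_nat (Suc n) / fact (Suc n) * fact n = (1 :: 'k)"
    by (simp add: fact_Suc del: of_nat_Suc)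
  finally show ?thesis by simp
qed

text \<open>Makes \<open>symmetrize M\<close> the average of the products that single out a last
  letter. The multiset sum counts repeated letters with multiplicity, as the sum over positions
  does.\<close>

lemma symmetrize_recurrence:
  "formal_scale (of_nat (size M)) (symmetrize M) = (\<Sum>c\<in>#M. symmetrize (M - {#c#}) * (word [c] :: 'a list \<Rightarrow>\<^sub>0 'k::field_char_0))"
proof (cases "M = {#}")
  case False
  obtain xs where M: "M = mset xs" by (metis ex_mset)
  then obtain n where n: "length xs = Suc n" using False by (cases xs) auto
  have "(\<Sum>c\<in>#M. symmetrize (M - {#c#}) * word [c])
    = (\<Sum>b\<le>n. symmetrize (mset xs - {#xs ! b#}) * (word [xs ! b] :: 'a list \<Rightarrow>\<^sub>0 'k))"
    by (simp only: M sum_mset_sum_list mset_map[symmetric] sum_list_sum_nth length_map n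
         atLeast0LessThan lessThan_Suc_atMost) (auto simp: n intro!: sum.cong)
  then show ?thesis using sym_list_recurrence[OF n] unfolding M size_mset n by simp
qed simp


section \<open>Ordered symmetric-bracket-block words in the free algebra\<close>

definition sym_bracket :: "'a multiset \<Rightarrow> 'a \<Rightarrow> 'a \<Rightarrow> ('a list \<Rightarrow>\<^sub>0 'k::field_char_0)" where
  "sym_bracket M y z = symmetrize M * (word [y, z] - word [z, y])"

text \<open>
  Greedy parsing into blocks: a maximal weakly decreasing run ending in \<open>z\<close> that is followed
  by a letter \<open>y \<succ> z\<close> encodes the OSB-word with bracket \<open>[y, z]\<close>. Every OSBB-word arises in this
  way from a word with the same letters.
\<close>

fun parse :: "'a rel \<Rightarrow> 'a multiset \<Rightarrow> 'a list \<Rightarrow> ('a list \<Rightarrow>\<^sub>0 'k::field_char_0)" where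
  "parse r M [] = symmetrize M"
| "parse r M [z] = symmetrize (add_mset z M)"
| "parse r M (z # y # w) =
     (if (y, z) \<in> r then parse r (add_mset z M) (y # w) else sym_bracket M y z * parse r {#} w)"

text \<open>Without an ascent no block is ever closed, so the accumulator absorbs every
  letter.\<close>

lemma parse_sorted:
  "sorted_wrt (\<lambda>a b. (b, a) \<in> r) xs \<Longrightarrow> parse r M xs = symmetrize (M + mset xs)"
  by (induction r M xs rule: parse.induct) (auto simp: add_mset_commute)

text \<open>The first ascent is from \<open>z\<close> to \<open>y\<close>: the letters of
  \<open>xs\<close> enter the accumulator, and parsing restarts with an empty one after
  \<open>y\<close>.\<close>

lemma parse_block:
  "sorted_wrt (\<lambda>a b. (b, a) \<in> r) (xs @ [z]) \<Longrightarrow> (y, z) \<notin> r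
   \<Longrightarrow> parse r M (xs @ z # y # w) = sym_bracket (M + mset xs) y z * parse r {#} w"
proof (induction xs arbitrary: M)
  case (Cons a xs)
  then show ?case by (cases xs) (auto simp: add_mset_commute)
qed simp

lemma sym_bracket_homogeneous: "sym_bracket M y z \<in> homogeneous (M + {#y, z#})"
proof -
  have "word [y, z] \<in> homogeneous {#y, z#}" "word [z, y] \<in> homogeneous {#y, z#}"
    using word_homogeneous[of "[y, z]"] word_homogeneous[of "[z, y]"]
    by (simp_all add: add_mset_commute)
  then have "word [y, z] - word [z, y] \<in> homogeneous {#y, z#}"
    unfolding homogeneous_def by (rule formal.span_diff)
  then show ?thesis
    unfolding sym_bracket_def by (rule homogeneous_mult[OF symmetrize_homogeneous])
qed

section \<open>OSBB-words graded by their multisets of letters\<close>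

locale ordered_alphabet =
  fixes C :: "'a set" and r :: "'a rel"
  assumes order: "linear_order_on C r"
begin

definition osb :: "'a multiset \<Rightarrow> 'a \<Rightarrow> 'a \<Rightarrow> bool" where
  "osb M y z \<longleftrightarrow> set_mset M \<subseteq> C \<and> y \<in> C \<and> z \<in> C \<and> (z, y) \<in> r \<and> z \<noteq> y \<and> (\<forall>x\<in>#M. (z, x) \<in> r)"

text \<open>The multiset of letters is carried along because it is not yet known that the element
  determines it.\<close>

inductive_set osbb :: "('a multiset \<times> ('a list \<Rightarrow>\<^sub>0 'k::field_char_0)) set" where
  base: "set_mset M \<subseteq> C \<Longrightarrow> (M, symmetrize M) \<in> osbb"
| step: "osb M y z \<Longrightarrow> (N, q) \<in> osbb \<Longrightarrow> (M + {#y, z#} + N, sym_bracket M y z * q) \<in> osbb"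

lemma osbb_homogeneous: "(M, q) \<in> osbb \<Longrightarrow> q \<in> homogeneous M"
  by (induction rule: osbb.induct)
     (blast intro: symmetrize_homogeneous homogeneous_mult[OF sym_bracket_homogeneous])+

lemma osbb_letters: "(M, q) \<in> osbb \<Longrightarrow> set_mset M \<subseteq> C"
  by (induction rule: osbb.induct) (auto simp: osb_def)

section \<open>Minima, decreasing listings and parsing\<close>

lemma r_refl: "x \<in> C \<Longrightarrow> (x, x) \<in> r"
  using order by (auto simp: order_on_defs refl_on_def)

lemma r_trans: "(x, y) \<in> r \<Longrightarrow> (y, z) \<in> r \<Longrightarrow> (x, z) \<in> r"
  using order by (auto simp: order_on_defs dest: transD)

lemma r_antisym: "(x, y) \<in> r \<Longrightarrow> (y, x) \<in> r \<Longrightarrow> x = y"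
  using order by (auto simp: order_on_defs dest: antisymD)

lemma r_total: "x \<in> C \<Longrightarrow> y \<in> C \<Longrightarrow> (x, y) \<in> r \<or> (y, x) \<in> r"
  using order r_refl by (cases "x = y") (auto simp: order_on_defs total_on_def)

lemma minimum_exists:
  assumes "finite A" "A \<noteq> {}" "A \<subseteq> C"
  shows "\<exists>z\<in>A. \<forall>x\<in>A. (z, x) \<in> r"
  using assms
proof (induction rule: finite_ne_induct)
  case (singleton x)
  then show ?case by (auto intro: r_refl)
next
  case (insert x A)
  then obtain z where z: "z \<in> A" "\<forall>x\<in>A. (z, x) \<in> r" by auto
  with insert.prems have "(x, z) \<in> r \<or> (z, x) \<in> r" by (intro r_total) auto
  then show ?case using z insert.prems by (auto intro: r_refl r_trans)
qed

text \<open>A minimum is put last and the remaining letters are listed recursively.\<close>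

lemma decreasing_list_exists:
  "set_mset M \<subseteq> C \<Longrightarrow> \<exists>xs. mset xs = M \<and> sorted_wrt (\<lambda>a b. (b, a) \<in> r) xs"
proof (induction "size M" arbitrary: M)
  case (Suc n)
  then have "set_mset M \<noteq> {}" by auto
  then obtain z where z: "z \<in># M" "\<forall>x\<in>#M. (z, x) \<in> r"
    using minimum_exists[of "set_mset M"] Suc.prems by auto
  obtain xs where xs: "mset xs = M - {#z#}" "sorted_wrt (\<lambda>a b. (b, a) \<in> r) xs"
  proof -
    have "n = size (M - {#z#})" "set_mset (M - {#z#}) \<subseteq> C"
      using Suc.hyps(2) Suc.prems z(1) by (auto simp: size_Diff_singleton dest: in_diffD)
    from Suc.hyps(1)[OF this] show ?thesis using that by blast
  qed
  have "set xs \<subseteq> set_mset M"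
    using xs(1)[THEN arg_cong[of _ _ set_mset]] by (auto dest: in_diffD)
  then have "sorted_wrt (\<lambda>a b. (b, a) \<in> r) (xs @ [z])"
    using xs(2) z by (auto simp: sorted_wrt_append)
  moreover have "mset (xs @ [z]) = M" using xs(1) z(1) by simp
  ultimately show ?case by blast
qed simp

text \<open>This bounds the number of OSBB-words by the number of words. A preimage lists the
  letters of each symmetric factor in decreasing order, followed by \<open>z\<close> and
  \<open>y\<close> for its bracket; minimality of \<open>z\<close> continues the run, and
  \<open>y\<close> breaks it.\<close>

lemma osbb_parse: "(M, q) \<in> osbb \<Longrightarrow> \<exists>w. mset w = M \<and> q = parse r {#} w"
proof (induction rule: osbb.induct)
  case (base M)
  then obtain xs where "mset xs = M" "sorted_wrt (\<lambda>a b. (b, a) \<in> r) xs"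
    using decreasing_list_exists by blast
  then show ?case using parse_sorted[of r xs "{#}"] by (metis add_0)
next
  case (step M y z N q)
  obtain w where w: "mset w = N" "q = parse r {#} w" using step.IH by auto
  obtain xs where xs: "mset xs = M" "sorted_wrt (\<lambda>a b. (b, a) \<in> r) xs"
    using decreasing_list_exists[of M] step.hyps by (auto simp: osb_def)
  have "sorted_wrt (\<lambda>a b. (b, a) \<in> r) (xs @ [z])"
    using xs step.hyps by (auto simp: sorted_wrt_append osb_def)
  moreover have "(y, z) \<notin> r" using step.hyps r_antisym by (auto simp: osb_def)
  ultimately have "parse r {#} (xs @ z # y # w) = sym_bracket M y z * q"
    using xs(1) w(2) by (simp add: parse_block)
  moreover have "mset (xs @ z # y # w) = M + {#y, z#} + N"
    using xs(1) w(1) by simp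
  ultimately show ?case by metis
qed


subsection \<open>Spanning\<close>

text \<open>The component with letters \<open>M\<close> of the right ideal generated by the
  OSB-words.\<close>

definition block_ideal :: "'a multiset \<Rightarrow> ('a list \<Rightarrow>\<^sub>0 'k::field_char_0) set" where
  "block_ideal M = formal.span {sym_bracket N y z * word w | N y z w. osb N y z \<and> N + {#y, z#} + mset w = M}"

lemma subspace_block_ideal: "formal.subspace (block_ideal M)"
  unfolding block_ideal_def by (rule formal.subspace_span)

lemma block_ideal_mult_letter:
  fixes p :: "'a list \<Rightarrow>\<^sub>0 'k::field_char_0"
  assumes "p \<in> block_ideal M"
  shows "p * word [c] \<in> block_ideal (add_mset c M)"
proof -
  have "word [c] \<in> formal.span {word [c]}" by (rule formal.span_base) simp
  with assms show ?thesis unfolding block_ideal_def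
  proof (rule span_mult_mem)
    fix x y :: "'a list \<Rightarrow>\<^sub>0 'k"
    assume "x \<in> {sym_bracket N y z * word w | N y z w. osb N y z \<and> N + {#y, z#} + mset w = M}"
      and y: "y \<in> {word [c]}"
    then obtain N b z w where x: "x = sym_bracket N b z * word w" "osb N b z" "N + {#b, z#} + mset w = M"
      by auto
    then have "x * y = sym_bracket N b z * word (w @ [c])" "N + {#b, z#} + mset (w @ [c]) = add_mset c M"
      using y by (auto simp: mult.assoc word_mult)
    then show "x * y \<in> formal.span {sym_bracket N y z * word w | N y z w.
        osb N y z \<and> N + {#y, z#} + mset w = add_mset c M}"
      using x(2) by (intro formal.span_base) blast
  qed
qed

text \<open>Modulo \<open>block_ideal M\<close> all products \<open>f d\<close> agree with the one
  for the minimal letter, hence with each other and with their average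
  \<open>symmetrize M\<close>.\<close>

lemma symmetrize_mult_letter:
  "set_mset M \<subseteq> C \<Longrightarrow> c \<in># M \<Longrightarrow>
   symmetrize (M - {#c#}) * word [c] - (symmetrize M :: 'a list \<Rightarrow>\<^sub>0 'k::field_char_0) \<in> block_ideal M"
proof (induction "size M" arbitrary: M c)
  case (Suc n)
  let ?S = "symmetrize :: _ \<Rightarrow> ('a list \<Rightarrow>\<^sub>0 'k)"
  define f where "f c = ?S (M - {#c#}) * word [c]" for c
  have "set_mset M \<noteq> {}" using Suc by auto
  then obtain z where z: "z \<in># M" "\<forall>x\<in>#M. (z, x) \<in> r"
    using minimum_exists[of "set_mset M"] Suc.prems by auto
  \<comment> \<open>With \<open>Q\<close> the rest of \<open>M\<close>, the induction hypothesis
    replaces \<open>symmetrize (add_mset d Q)\<close> by \<open>?S Q * word [d]\<close>, and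
    likewise for \<open>z\<close>. What remains of the difference is the OSB-word with bracket
    \<open>[d, z]\<close>.\<close>
  have fz: "f z - f d \<in> block_ideal M" if d: "d \<in># M" for d
  proof (cases "d = z")
    case False
    define Q where "Q = M - {#d#} - {#z#}"
    have "z \<in># M - {#d#}" using z(1) False by (metis insert_DiffM d insert_noteq_member)
    then have "M = add_mset d (add_mset z Q)"
      unfolding Q_def using d by (metis insert_DiffM)
    then have Q: "M = Q + {#d, z#}" by simp
    have "n = size (add_mset d Q)" "n = size (add_mset z Q)"
      using Suc.hyps(2) by (simp_all add: Q)
    moreover have "set_mset Q \<subseteq> C" "d \<in> C" "z \<in> C"
      using Suc.prems(1) by (auto simp: Q)
    ultimately have "?S Q * word [d] - ?S (add_mset d Q) \<in> block_ideal (add_mset d Q)"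
      and "?S Q * word [z] - ?S (add_mset z Q) \<in> block_ideal (add_mset z Q)"
      using Suc.hyps(1)[of "add_mset d Q" d] Suc.hyps(1)[of "add_mset z Q" z] by auto
    from this(1)[THEN block_ideal_mult_letter, of z] this(2)[THEN block_ideal_mult_letter, of d]
    have 1: "(?S Q * word [d] - ?S (add_mset d Q)) * word [z] \<in> block_ideal M"
      and 2: "(?S Q * word [z] - ?S (add_mset z Q)) * word [d] \<in> block_ideal M"
      by (simp_all add: Q add_mset_commute)
    have "osb Q d z"
      using Suc.prems(1) z False d unfolding osb_def by (auto simp: Q)
    then have 3: "sym_bracket Q d z * word [] \<in> block_ideal M"
      unfolding block_ideal_def by (intro formal.span_base) (force simp: Q)
    have "f z - f d = sym_bracket Q d z * word [] - (?S Q * word [d] - ?S (add_mset d Q)) * word [z]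
        + (?S Q * word [z] - ?S (add_mset z Q)) * word [d]"
      by (simp add: f_def Q sym_bracket_def algebra_simps word_mult)
    with 1 2 3 show ?thesis
      using formal.subspace_add[OF subspace_block_ideal] formal.subspace_diff[OF subspace_block_ideal] by metis
  qed (simp add: formal.subspace_0[OF subspace_block_ideal])
  have fd: "f c - f d \<in> block_ideal M" if "d \<in># M" for d
    using formal.subspace_diff[OF subspace_block_ideal fz[OF that] fz[OF Suc.prems(2)]] by simp
  \<comment> \<open>A submultiset-like \<open>N\<close> is used for induction while \<open>M\<close>
    stays fixed; it is later taken to be \<open>M\<close>.\<close>
  have "(\<Sum>d\<in>#N. f c - f d) \<in> block_ideal M" if "set_mset N \<subseteq> set_mset M" for N
    using that by (induction N)
      (auto intro!: formal.subspace_add[OF subspace_block_ideal] fd formal.subspace_0[OF subspace_block_ideal])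
  moreover have "(\<Sum>d\<in>#N. f c - f d) = formal_scale (of_nat (size N)) (f c) - (\<Sum>d\<in>#N. f d)" for N
    by (induction N) (auto simp: formal.scale_left_distrib)
  ultimately have "formal_scale (of_nat (size M)) (f c - ?S M) \<in> block_ideal M"
    by (simp add: f_def formal.scale_right_diff_distrib symmetrize_recurrence)
  \<comment> \<open>Dividing by the nonzero size of \<open>M\<close> is possible in characteristic
    zero.\<close>
  from formal.subspace_scale[OF subspace_block_ideal this, of "inverse (of_nat (size M))"]
  show ?case using of_nat_neq_0[of n, where 'a = 'k] by (simp add: f_def flip: Suc.hyps(2))
qed simp

text \<open>The last letter \<open>c\<close> is split off and the rest expanded in OSBB-words, so
  only an OSBB-word times \<open>c\<close> has to be rewritten.\<close>

lemma words_in_span_osbb: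
  "set w \<subseteq> C \<Longrightarrow> word w \<in> formal.span {q :: 'a list \<Rightarrow>\<^sub>0 'k::field_char_0. (mset w, q) \<in> osbb}"
proof (induction "length w" arbitrary: w rule: less_induct)
  case less
  let ?O = "\<lambda>M. {q :: 'a list \<Rightarrow>\<^sub>0 'k. (M, q) \<in> osbb}"
  \<comment> \<open>The bracket uses up two letters, so the words in \<open>p\<close> are shorter
    than \<open>w\<close> and the induction hypothesis expands them; prefixing an OSB-word preserves
    OSBB-words.\<close>
  have block: "sym_bracket N y z * p \<in> formal.span (?O (N + {#y, z#} + M))"
    if osb: "osb N y z" and p: "p \<in> homogeneous M" and M: "N + {#y, z#} + M = mset w" for N y z p M
  proof -
    have "word v \<in> formal.span (?O M)" if "mset v = M" for v
    proof -
      have "mset w = N + {#y, z#} + mset v" using M that by simp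
      from arg_cong[OF this, of size] arg_cong[OF this, of set_mset]
      have "length v < length w" "set v \<subseteq> set w" by auto
      then show ?thesis using less.hyps[of v] less.prems that by auto
    qed
    then have "homogeneous M \<subseteq> formal.span (?O M)"
      unfolding homogeneous_def by (intro formal.span_minimal) auto
    with p have "p \<in> formal.span (?O M)" by auto
    then show ?thesis
    proof (rule span_mult_mem[rotated])
      show "sym_bracket N y z \<in> formal.span {sym_bracket N y z}" by (rule formal.span_base) simp
    next
      fix x q :: "'a list \<Rightarrow>\<^sub>0 'k"
      assume "x \<in> {sym_bracket N y z}" "q \<in> ?O M"
      then show "x * q \<in> formal.span (?O (N + {#y, z#} + M))"
        using osbb.step[OF osb, of M q] by (intro formal.span_base) simp
    qed
  qed
  show ?case
  proof (cases w rule: rev_cases)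
    case Nil
    have "(mset w, symmetrize {#} :: 'a list \<Rightarrow>\<^sub>0 'k) \<in> osbb"
      using osbb.base[of "{#}"] Nil by simp
    moreover have "symmetrize {#} = (word w :: 'a list \<Rightarrow>\<^sub>0 'k)"
      using symmetrize_mset[of "[]"] by (simp add: Nil sym_list_def permute_list_def)
    ultimately show ?thesis by (intro formal.span_base) simp
  next
    case (snoc u c)
    have u: "word u \<in> formal.span (?O (mset u))" using less by (simp add: snoc)
    have c: "word [c] \<in> formal.span {word [c]}" by (rule formal.span_base) simp
    have "word u * word [c] \<in> formal.span (?O (mset w))"
    proof (rule span_mult_mem[OF u c])
      fix q l :: "'a list \<Rightarrow>\<^sub>0 'k"
      assume "q \<in> ?O (mset u)" and l: "l \<in> {word [c]}"
      then have "(mset u, q) \<in> osbb" by simp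
      then show "q * l \<in> formal.span (?O (mset w))"
      proof cases
        \<comment> \<open>A symmetric word times \<open>c\<close> is the larger symmetric word
          modulo \<open>block_ideal (mset w)\<close>, whose generators are covered by
          \<open>block\<close>.\<close>
        case base
        have wC: "set_mset (mset w) \<subseteq> C" using less.prems by simp
        have "block_ideal (mset w) \<subseteq> formal.span (?O (mset w))"
          unfolding block_ideal_def
        proof (rule formal.span_minimal, safe)
          fix N y z v assume "osb N y z" and M: "N + {#y, z#} + mset v = mset w"
          from block[OF this(1) word_homogeneous M]
          show "sym_bracket N y z * word v \<in> formal.span (?O (mset w))" by (simp only: M)
        qed
        then have "symmetrize (mset w - {#c#}) * word [c] - symmetrize (mset w) \<in> formal.span (?O (mset w))"
          using symmetrize_mult_letter[OF wC, of c] by (auto simp: snoc)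
        moreover have "symmetrize (mset w) \<in> formal.span (?O (mset w))"
          using osbb.base[OF wC] by (intro formal.span_base) simp
        ultimately have "symmetrize (mset w - {#c#}) * word [c] \<in> formal.span (?O (mset w))"
          by (metis formal.span_add diff_add_cancel)
        then show ?thesis using l base by (simp add: snoc)
      next
        \<comment> \<open>The letter \<open>c\<close> is absorbed into the factor after the first
          block, to which \<open>block\<close> applies.\<close>
        case (step M y z N p)
        have "p * word [c] \<in> homogeneous (N + {#c#})"
          using homogeneous_mult[OF osbb_homogeneous[OF step(4)] word_homogeneous[of "[c]"]] by simp
        moreover have M: "M + {#y, z#} + (N + {#c#}) = mset w"
          using step(1) by (simp add: snoc)
        ultimately have "sym_bracket M y z * (p * word [c]) \<in> formal.span (?O (mset w))"
          using block[OF step(3)] by (simp only: M)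
        then show ?thesis using l step(2) by (simp add: mult.assoc)
      qed
    qed
    then show ?thesis by (simp add: snoc word_mult)
  qed
qed


subsection \<open>Independence\<close>

definition osbb_elements :: "('a list \<Rightarrow>\<^sub>0 'k::field_char_0) set" where
  "osbb_elements = {q. \<exists>M. (M, q) \<in> osbb}"

lemma span_osbb_elements:
  "formal.span osbb_elements = formal.span (word ` {w. set w \<subseteq> C} :: ('a list \<Rightarrow>\<^sub>0 'k::field_char_0) set)"
proof (rule formal.span_eq[THEN iffD2], safe)
  fix w assume "set w \<subseteq> C"
  from words_in_span_osbb[OF this]
  show "(word w :: 'a list \<Rightarrow>\<^sub>0 'k) \<in> formal.span osbb_elements"
    by (rule rev_subsetD) (auto intro!: formal.span_mono simp: osbb_elements_def)
next
  fix q :: "'a list \<Rightarrow>\<^sub>0 'k"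
  assume "q \<in> osbb_elements"
  then obtain M where M: "(M, q) \<in> osbb" by (auto simp: osbb_elements_def)
  from osbb_homogeneous[OF M] show "q \<in> formal.span (word ` {w. set w \<subseteq> C})"
    unfolding homogeneous_def
    by (rule rev_subsetD) (use osbb_letters[OF M] in \<open>auto intro!: formal.span_mono\<close>)
qed

text \<open>A finite set of OSBB-words is enlarged to a finite set \<open>B\<close> that spans at
  least as many independent words as it has elements.\<close>

lemma independent_osbb_elements:
  "formal.independent (osbb_elements :: ('a list \<Rightarrow>\<^sub>0 'k::field_char_0) set)"
  unfolding formal.independent_explicit_finite_subsets
proof (intro allI impI)
  fix S :: "('a list \<Rightarrow>\<^sub>0 'k) set" and c
  assume S: "S \<subseteq> osbb_elements" "finite S" and 0: "(\<Sum>v\<in>S. formal_scale (c v) v) = 0"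
  have "\<forall>q\<in>S. \<exists>M. (M, q) \<in> osbb" using S(1) by (auto simp: osbb_elements_def)
  then obtain m where m: "\<And>q. q \<in> S \<Longrightarrow> (m q, q) \<in> osbb" by metis
  define F where "F = (\<Union>q\<in>S. set_mset (m q))"
  define n where "n = (\<Sum>q\<in>S. size (m q))"
  \<comment> \<open>Bounding letters and length makes \<open>W\<close> finite and closed under
    rearrangement; \<open>n\<close> is a sum so that it bounds every
    \<open>size (m q)\<close>.\<close>
  define W where "W = {w. set w \<subseteq> F \<and> length w \<le> n}"
  define B where "B = {q :: 'a list \<Rightarrow>\<^sub>0 'k. \<exists>w\<in>W. (mset w, q) \<in> osbb}"
  have F: "finite F" "F \<subseteq> C" using S(2) osbb_letters[OF m] by (auto simp: F_def)
  have finW: "finite W" unfolding W_def by (rule finite_lists_length_le[OF F(1)])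
  have SB: "S \<subseteq> B"
  proof
    fix q assume q: "q \<in> S"
    obtain w where w: "mset w = m q" by (metis ex_mset)
    have "set w \<subseteq> F" using q w by (auto simp: F_def simp flip: set_mset_mset)
    moreover have "length w \<le> n"
      using member_le_sum[OF q, of "\<lambda>q. size (m q)"] S(2) w by (simp add: n_def flip: size_mset)
    ultimately show "q \<in> B" using m[OF q] w by (auto simp: B_def W_def)
  qed
  have BW: "B \<subseteq> parse r {#} ` W"
  proof
    fix q assume "q \<in> B"
    then obtain v where v: "v \<in> W" "(mset v, q) \<in> osbb" by (auto simp: B_def)
    obtain w where w: "mset w = mset v" "q = parse r {#} w" using osbb_parse[OF v(2)] by auto
    with v(1) have "w \<in> W" using mset_eq_setD[OF w(1)] mset_eq_length[OF w(1)] by (simp add: W_def)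
    with w show "q \<in> parse r {#} ` W" by auto
  qed
  have finB: "finite B" using BW finW by (auto intro: finite_subset)
  have WB: "word ` W \<subseteq> formal.span B"
  proof safe
    fix w assume w: "w \<in> W"
    then have "set w \<subseteq> C" using F by (auto simp: W_def)
    from words_in_span_osbb[OF this] show "word w \<in> formal.span B"
      by (rule rev_subsetD) (use w in \<open>auto intro!: formal.span_mono simp: B_def\<close>)
  qed
  \<comment> \<open>The independent words from \<open>W\<close> lie in the span of
    \<open>B'\<close>, giving \<open>card W \<le> card B' \<le> card B \<le> card W\<close>. Hence
    \<open>B'\<close> is all of \<open>B\<close>.\<close>
  obtain B' where B': "B' \<subseteq> B" "formal.independent B'" "B \<subseteq> formal.span B'"
    using formal.maximal_independent_subset .
  have "formal.independent (word ` W :: ('a list \<Rightarrow>\<^sub>0 'k) set)"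
    by (rule formal.independent_mono[OF independent_words]) auto
  moreover have "word ` W \<subseteq> formal.span B'"
    using WB B'(3) by (meson formal.span_minimal formal.subspace_span subset_trans)
  ultimately have "card (word ` W :: ('a list \<Rightarrow>\<^sub>0 'k) set) \<le> card B'"
    using formal.independent_span_bound finB B'(1) finite_subset by blast
  moreover have "card (word ` W :: ('a list \<Rightarrow>\<^sub>0 'k) set) = card W"
    by (rule card_image) (rule inj_on_subset[OF inj_word], simp)
  moreover have "card B \<le> card W"
    using card_mono[OF _ BW] card_image_le[OF finW, of "parse r {#} :: _ \<Rightarrow> ('a list \<Rightarrow>\<^sub>0 'k)"] finW by simp
  ultimately have "B' = B" using B'(1) finB by (intro card_seteq) auto
  with B'(2) SB have "formal.independent S" using formal.independent_mono by auto
  then show "\<forall>v\<in>S. c v = 0" using formal.independentD[OF _ S(2) _ 0] by auto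
qed

end

section \<open>Passing to the tensor algebra\<close>

lemma tensor_class_eq_iff:
  "tensor_class scale p = tensor_class scale q \<longleftrightarrow> p - q \<in> tensor_kernel scale"
proof
  assume "tensor_class scale p = tensor_class scale q"
  moreover have "p \<in> tensor_class scale p"
    using formal.subspace_0[OF tensor_kernel_subspace] by (auto simp: tensor_class_eq)
  ultimately show "p - q \<in> tensor_kernel scale" by (auto simp: tensor_class_eq)
next
  have sub: "tensor_class scale a \<subseteq> tensor_class scale b" if ab: "a - b \<in> tensor_kernel scale" for a b
  proof
    fix x assume "x \<in> tensor_class scale a"
    then obtain n where n: "n \<in> tensor_kernel scale" "x = n + a" by (auto simp: tensor_class_eq)
    have "n + (a - b) \<in> tensor_kernel scale"
      by (rule formal.subspace_add[OF tensor_kernel_subspace n(1) ab])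
    then show "x \<in> tensor_class scale b"
      unfolding tensor_class_eq n(2) by (auto intro!: exI[of _ "n + (a - b)"])
  qed
  assume pq: "p - q \<in> tensor_kernel scale"
  have "q - p \<in> tensor_kernel scale"
    using formal.subspace_neg[OF tensor_kernel_subspace pq] by simp
  with pq show "tensor_class scale p = tensor_class scale q" using sub by blast
qed

lemma tensor_class_in_carrier: "tensor_class scale p \<in> carrier (tensor_algebra scale)"
  by (auto simp: tensor_class_carrier)

lemma tensor_class_zero: "\<zero>\<^bsub>tensor_algebra scale\<^esub> = tensor_class scale 0"
  by (simp add: tensor_algebra_simps FactRing_def tensor_class_eq)

lemma tensor_class_finsum:
  assumes "finite A"
  shows "(\<Oplus>\<^bsub>tensor_algebra scale\<^esub>b\<in>A. tensor_class scale (g b)) = tensor_class scale (\<Sum>b\<in>A. g b)"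
proof -
  interpret T: ring "tensor_algebra scale" by (rule tensor_algebra_ring)
  show ?thesis using assms
    by (induction A) (auto simp: tensor_class_zero tensor_class_in_carrier tensor_class_add)
qed

lemma tensor_class_minus:
  "tensor_class scale p \<ominus>\<^bsub>tensor_algebra scale\<^esub> tensor_class scale q = tensor_class scale (p - q)"
proof -
  interpret T: ring "tensor_algebra scale" by (rule tensor_algebra_ring)
  have "\<ominus>\<^bsub>tensor_algebra scale\<^esub> tensor_class scale q = tensor_class scale (- q)"
    by (rule T.minus_equality) (auto simp: tensor_class_zero tensor_class_in_carrier tensor_class_add)
  then show ?thesis by (simp add: a_minus_def tensor_class_add)
qed

lemma symmetrization_eq: "symmetrization scale xs = tensor_class scale (sym_list xs)"
  by (simp add: symmetrization_def tensor_word_def tensor_class_finsum finite_permutations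
      tensor_class_smult sym_list_def)

lemma symmetric_bracket_word_eq:
  "symmetric_bracket_word scale xs y z = tensor_class scale (sym_bracket (mset xs) y z)"
  by (simp add: symmetric_bracket_word_def symmetrization_eq bracket_def tensor_word_def
      tensor_class_mult tensor_class_minus sym_bracket_def word_mult)

text \<open>The fold over the blocks mirrors the rules \<open>base\<close> and \<open>step\<close>,
  since products of classes are classes of products. The empty list of blocks gives the symmetric
  words.\<close>

lemma OSBB_words_eq:
  fixes scale :: "'k::field_char_0 \<Rightarrow> 'w::ab_group_add \<Rightarrow> 'w"
  assumes "linear_order_on C r"
  shows "OSBB_words scale C r = tensor_class scale ` ordered_alphabet.osbb_elements C r"
proof
  interpret ordered_alphabet C r by standard (rule assms)
  have "\<exists>q\<in>osbb_elements. foldr (\<otimes>\<^bsub>tensor_algebra scale\<^esub>) ws v = tensor_class scale q"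
    if ws: "set ws \<subseteq> OSB_words scale C r" and v: "v \<in> symmetric_words scale C" for ws v
    using ws
  proof (induction ws)
    case Nil
    obtain xs where xs: "v = symmetrization scale xs" "set xs \<subseteq> C"
      using v by (auto simp: symmetric_words_def)
    then have "(mset xs, sym_list xs) \<in> osbb" using base[of "mset xs"] by simp
    then show ?case using xs by (auto simp: symmetrization_eq osbb_elements_def)
  next
    case (Cons a ws)
    then obtain q N where q: "(N, q) \<in> osbb" "foldr (\<otimes>\<^bsub>tensor_algebra scale\<^esub>) ws v = tensor_class scale q"
      by (auto simp: osbb_elements_def)
    obtain xs y z where a: "a = tensor_class scale (sym_bracket (mset xs) y z)" "osb (mset xs) y z"
      using Cons.prems by (auto simp: OSB_words_def osb_def symmetric_bracket_word_eq)
    have "sym_bracket (mset xs) y z * q \<in> osbb_elements"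
      using step[OF a(2) q(1)] by (auto simp: osbb_elements_def)
    moreover have "foldr (\<otimes>\<^bsub>tensor_algebra scale\<^esub>) (a # ws) v
        = tensor_class scale (sym_bracket (mset xs) y z * q)"
      by (simp add: q(2) a(1) tensor_class_mult)
    ultimately show ?case by blast
  qed
  then show "OSBB_words scale C r \<subseteq> tensor_class scale ` osbb_elements"
    unfolding OSBB_words_def by blast
next
  interpret ordered_alphabet C r by standard (rule assms)
  have "tensor_class scale q \<in> OSBB_words scale C r" if "(M, q) \<in> osbb" for M q
    using that
  proof (induction rule: osbb.induct)
    case (base M)
    obtain xs where xs: "M = mset xs" by (metis ex_mset)
    with base have "tensor_class scale (symmetrize M) \<in> symmetric_words scale C"
      unfolding symmetric_words_def by (auto simp: symmetrization_eq)
    then show ?case unfolding OSBB_words_def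
      by (intro CollectI exI[of _ "[]"] exI[of _ "tensor_class scale (symmetrize M)"]) simp
  next
    case (step M y z N q)
    obtain ws v where q: "tensor_class scale q = foldr (\<otimes>\<^bsub>tensor_algebra scale\<^esub>) ws v"
      "set ws \<subseteq> OSB_words scale C r" "v \<in> symmetric_words scale C"
      using step.IH by (auto simp: OSBB_words_def)
    obtain xs where xs: "M = mset xs" by (metis ex_mset)
    have "symmetric_bracket_word scale xs y z \<in> OSB_words scale C r"
      using step.hyps(1) by (auto simp: OSB_words_def osb_def xs)
    moreover have "tensor_class scale (sym_bracket M y z * q)
        = foldr (\<otimes>\<^bsub>tensor_algebra scale\<^esub>) (symmetric_bracket_word scale xs y z # ws) v"
      by (simp add: xs symmetric_bracket_word_eq flip: q(1) tensor_class_mult)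
    ultimately show ?case using q(2,3) unfolding OSBB_words_def
      by (intro CollectI exI[of _ "symmetric_bracket_word scale xs y z # ws"] exI[of _ v]) simp
  qed
  then show "tensor_class scale ` osbb_elements \<subseteq> OSBB_words scale C r"
    by (auto simp: osbb_elements_def)
qed

text \<open>\<open>L\<close> shows that words over \<open>C\<close> remain independent modulo the
  multilinear relations. It expands each letter through a linear map fixing \<open>C\<close> and
  multiplies the results.\<close>

lemma tensor_retraction:
  fixes scale :: "'k::field \<Rightarrow> 'w::ab_group_add \<Rightarrow> 'w"
  assumes "vector_space scale" and C: "\<not> module.dependent scale C"
  obtains L :: "('w list \<Rightarrow>\<^sub>0 'k) \<Rightarrow> ('w list \<Rightarrow>\<^sub>0 'k)"
  where "Vector_Spaces.linear formal_scale formal_scale L"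
    and "\<And>p. p \<in> tensor_kernel scale \<Longrightarrow> L p = 0"
    and "\<And>w. set w \<subseteq> C \<Longrightarrow> L (word w) = word w"
proof -
  interpret W: vector_space scale by fact
  interpret VW: vector_space_pair scale "formal_scale :: 'k \<Rightarrow> ('w list \<Rightarrow>\<^sub>0 'k) \<Rightarrow> _" ..
  interpret VV: vector_space_pair "formal_scale :: 'k \<Rightarrow> ('w list \<Rightarrow>\<^sub>0 'k) \<Rightarrow> _"
      "formal_scale :: 'k \<Rightarrow> ('w list \<Rightarrow>\<^sub>0 'k) \<Rightarrow> _" ..
  obtain e where e: "Vector_Spaces.linear scale (formal_scale :: 'k \<Rightarrow> ('w list \<Rightarrow>\<^sub>0 'k) \<Rightarrow> _) e"
    and eC: "\<And>c. c \<in> C \<Longrightarrow> e c = word [c]"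
    using VW.linear_independent_extend[OF C, of "\<lambda>c. word [c]"] by auto
  \<comment> \<open>\<open>L\<close> is prescribed on the independent formal words;
    \<open>the_inv word\<close> recovers the list from such an element.\<close>
  obtain L where L: "Vector_Spaces.linear formal_scale formal_scale L"
    and "\<forall>p\<in>range word. L p = prod_list (map e (the_inv word p))"
    using VV.linear_independent_extend[OF independent_words, of "\<lambda>p. prod_list (map e (the_inv word p))"]
    by auto
  then have Lw: "L (word u) = prod_list (map e u)" for u
    by (simp add: the_inv_f_f[OF inj_word])
  interpret e: Vector_Spaces.linear scale "formal_scale :: 'k \<Rightarrow> ('w list \<Rightarrow>\<^sub>0 'k) \<Rightarrow> _" e by (rule e)
  interpret L: Vector_Spaces.linear formal_scale formal_scale L by (rule L)
  \<comment> \<open>The product of the values of \<open>e\<close> is linear in each letter.\<close>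
  have rel: "L p = 0" if "p \<in> multilinear_relations scale" for p
    using that unfolding multilinear_relations_def
    by (auto simp: L.diff L.scale Lw e.add e.scale distrib_left distrib_right
        formal_scale_mult_left formal_scale_mult_right)
  have "L p = 0" if "p \<in> tensor_kernel scale" for p
    using that unfolding tensor_kernel_def
    by (induction rule: formal.span_induct_alt) (auto simp: L.add L.scale rel L.zero)
  moreover have "prod_list (map e w) = word w" if "set w \<subseteq> C" for w
    using that by (induction w) (auto simp: eC word_mult word_Nil)
  ultimately show ?thesis using that[OF L] Lw by simp
qed

text \<open>Since \<open>C\<close> spans, multilinearity expands single letters, the ideal property
  extends this to words, and linearity to all formal combinations.\<close>

lemma tensor_class_representative:
  fixes scale :: "'k::field \<Rightarrow> 'w::ab_group_add \<Rightarrow> 'w"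
  assumes "vector_space scale" and C: "module.span scale C = UNIV"
  obtains q where "q \<in> formal.span (word ` {w. set w \<subseteq> C})" "tensor_class scale p = tensor_class scale q"
proof -
  interpret W: vector_space scale by fact
  let ?V = "formal.span (word ` {w. set w \<subseteq> C}) :: ('w list \<Rightarrow>\<^sub>0 'k) set"
  let ?K = "tensor_kernel scale"
  note K_add = formal.subspace_add[OF tensor_kernel_subspace]
    and K_scale = formal.subspace_scale[OF tensor_kernel_subspace]
    and K_0 = formal.subspace_0[OF tensor_kernel_subspace]
  have rel: "p \<in> ?K" if "p \<in> multilinear_relations scale" for p
    using that unfolding tensor_kernel_def by (rule formal.span_base)
  have V_mult: "p * q \<in> ?V" if "p \<in> ?V" "q \<in> ?V" for p q
    using that by (rule span_mult_mem) (auto simp: word_mult intro!: formal.span_base)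
  have add: "word [x + y] - word [x] - word [y] \<in> ?K" for x y
    by (rule rel) (unfold multilinear_relations_def, rule UnI1, rule CollectI,
        intro exI[of _ "[]"] exI[of _ x] exI[of _ y], simp)
  have scale: "word [scale a x] - formal_scale a (word [x]) \<in> ?K" for a x
    by (rule rel) (unfold multilinear_relations_def, rule UnI2, rule CollectI,
        intro exI[of _ "[]"] exI[of _ a] exI[of _ x], simp)
  have letter: "\<exists>q\<in>?V. word [x] - q \<in> ?K" for x
  proof -
    have "x \<in> W.span C" using C by simp
    then show ?thesis
    proof (induction rule: W.span_induct_alt)
      case base
      have "word [0] - 0 \<in> ?K" using scale[of 0 0] by simp
      then show ?case using formal.span_zero by blast
    next
      case (step a c y)
      then obtain q where q: "q \<in> ?V" "word [y] - q \<in> ?K" by auto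
      have "formal_scale a (word [c]) + q \<in> ?V"
        using step(1) q(1) by (intro formal.span_add formal.span_scale) (auto intro: formal.span_base)
      moreover have "word [scale a c + y] - (formal_scale a (word [c]) + q) \<in> ?K"
        using K_add[OF K_add[OF add[of "scale a c" y] scale[of a c]] q(2)] by (simp add: algebra_simps)
      ultimately show ?case by blast
    qed
  qed
  have word: "\<exists>q\<in>?V. word u - q \<in> ?K" for u
  proof (induction u)
    case Nil
    have "word [] \<in> ?V" by (rule formal.span_base) auto
    then show ?case using K_0 by force
  next
    case (Cons x u)
    obtain q q' where q: "q \<in> ?V" "word [x] - q \<in> ?K" "q' \<in> ?V" "word u - q' \<in> ?K"
      using Cons letter by blast
    \<comment> \<open>Telescoping replaces one factor at a time, so each error lies in the two-sided
      ideal \<open>?K\<close>.\<close>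
    have "(word [x] - q) * word u + q * (word u - q') \<in> ?K"
      using q(2,4) by (intro K_add) (auto dest: tensor_kernel_mult)
    then have "word (x # u) - q * q' \<in> ?K" by (simp add: algebra_simps word_mult)
    then show ?case using V_mult[OF q(1,3)] by blast
  qed
  have "\<exists>q\<in>?V. p - q \<in> ?K"
  proof (induction p rule: formal_induct)
    case (1 u a)
    obtain q where q: "q \<in> ?V" "word u - q \<in> ?K" using word by blast
    have "Poly_Mapping.single u a - formal_scale a q \<in> ?K"
      using K_scale[OF q(2), of a] by (simp add: formal.scale_right_diff_distrib formal_scale_single)
    then show ?case using formal.span_scale[OF q(1)] by blast
  next
    case (2 p p')
    then obtain q q' where q: "q \<in> ?V" "p - q \<in> ?K" "q' \<in> ?V" "p' - q' \<in> ?K" by blast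
    have "p + p' - (q + q') \<in> ?K" using K_add[OF q(2,4)] by (simp add: algebra_simps)
    then show ?case using formal.span_add[OF q(1,3)] by blast
  qed
  then show ?thesis using that tensor_class_eq_iff by blast
qed

section \<open>Transfer of the basis along the quotient map\<close>

theorem theorem5p1:
  fixes scale :: "'k::field_char_0 \<Rightarrow> 'w::ab_group_add \<Rightarrow> 'w"
    and C :: "'w set" and r :: "'w rel"
  assumes "vector_space scale"
    and "\<not> module.dependent scale C" and "module.span scale C = UNIV"
    and "linear_order_on C r"
  shows "is_basis (tensor_algebra scale) (OSBB_words scale C r)"
proof -
  interpret ordered_alphabet C r by standard (rule assms(4))
  let ?T = "tensor_algebra scale" and ?B = "osbb_elements :: ('w list \<Rightarrow>\<^sub>0 'k) set"
  let ?V = "formal.span ?B"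
  obtain L where L: "Vector_Spaces.linear formal_scale formal_scale L"
    and LK: "\<And>p. p \<in> tensor_kernel scale \<Longrightarrow> L p = 0"
    and LC: "\<And>w. set w \<subseteq> C \<Longrightarrow> L (word w) = word w"
    using tensor_retraction[OF assms(1,2)] by blast
  interpret L: Vector_Spaces.linear formal_scale formal_scale L by (rule L)
  have LV: "L p = p" if "p \<in> ?V" for p
    using that unfolding span_osbb_elements
    by (induction rule: formal.span_induct_alt) (auto simp: L.add L.scale L.zero LC)
  \<comment> \<open>\<open>L\<close> is the identity on \<open>?V\<close> and zero on the kernel, so
    the two meet only in zero and classes are injective on \<open>?V\<close>.\<close>
  have kernel: "p = 0" if "p \<in> ?V" "p \<in> tensor_kernel scale" for p
    using LV LK that by metis
  have inj: "inj_on (tensor_class scale) ?V"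
    by (rule inj_onI) (metis tensor_class_eq_iff kernel formal.span_diff eq_iff_diff_eq_0)
  have comb: "(\<Oplus>\<^bsub>?T\<^esub>b\<in>tensor_class scale ` S. c b \<odot>\<^bsub>?T\<^esub> b)
      = tensor_class scale (\<Sum>p\<in>S. formal_scale (c (tensor_class scale p)) p)"
    if S: "finite S" "S \<subseteq> ?B" for S c
  proof -
    interpret T: ring ?T by (rule tensor_algebra_ring)
    have "inj_on (tensor_class scale) S"
      using inj S(2) formal.span_superset by (blast intro: inj_on_subset)
    then have "(\<Oplus>\<^bsub>?T\<^esub>b\<in>tensor_class scale ` S. c b \<odot>\<^bsub>?T\<^esub> b)
        = (\<Oplus>\<^bsub>?T\<^esub>p\<in>S. tensor_class scale (formal_scale (c (tensor_class scale p)) p))"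
      by (subst T.add.finprod_reindex) (auto simp: tensor_class_smult tensor_class_in_carrier)
    then show ?thesis using S(1) by (simp add: tensor_class_finsum)
  qed
  have "lin_independent ?T (tensor_class scale ` ?B)"
    unfolding lin_independent_def
  proof (intro allI impI ballI, elim conjE)
    fix A c b
    assume A: "finite A" "A \<subseteq> tensor_class scale ` ?B" "(\<Oplus>\<^bsub>?T\<^esub>b\<in>A. c b \<odot>\<^bsub>?T\<^esub> b) = \<zero>\<^bsub>?T\<^esub>" and b: "b \<in> A"
    obtain S where S: "S \<subseteq> ?B" "finite S" "A = tensor_class scale ` S"
      using finite_subset_image[OF A(1,2)] by blast
    let ?p = "\<Sum>p\<in>S. formal_scale (c (tensor_class scale p)) p"
    have "tensor_class scale ?p = tensor_class scale 0"
      using A(3) S by (simp add: comb tensor_class_zero)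
    then have "?p \<in> tensor_kernel scale" by (simp add: tensor_class_eq_iff)
    moreover have "?p \<in> ?V"
      using S(1) by (intro formal.span_sum formal.span_scale formal.span_base) auto
    ultimately have "?p = 0" by (rule kernel[rotated])
    from formal.independentD[OF independent_osbb_elements S(2,1) this] b S(3)
    show "c b = 0" by auto
  qed
  moreover have "lin_span ?T (tensor_class scale ` ?B) = carrier ?T"
  proof
    show "lin_span ?T (tensor_class scale ` ?B) \<subseteq> carrier ?T"
    proof
      fix t assume "t \<in> lin_span ?T (tensor_class scale ` ?B)"
      then obtain A c where A: "finite A" "A \<subseteq> tensor_class scale ` ?B" "t = (\<Oplus>\<^bsub>?T\<^esub>b\<in>A. c b \<odot>\<^bsub>?T\<^esub> b)"
        by (auto simp: lin_span_def)
      obtain S where "S \<subseteq> ?B" "finite S" "A = tensor_class scale ` S"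
        using finite_subset_image[OF A(1,2)] by blast
      then show "t \<in> carrier ?T" using A(3) by (simp add: comb tensor_class_in_carrier)
    qed
  next
    show "carrier ?T \<subseteq> lin_span ?T (tensor_class scale ` ?B)"
    proof
      fix t assume "t \<in> carrier ?T"
      then obtain p where "t = tensor_class scale p" by (auto simp: tensor_class_carrier)
      then obtain q where q: "q \<in> ?V" "t = tensor_class scale q"
        using tensor_class_representative[OF assms(1,3), of p] unfolding span_osbb_elements by metis
      obtain S d where S: "finite S" "S \<subseteq> ?B" "q = (\<Sum>p\<in>S. formal_scale (d p) p)"
        using q(1) unfolding formal.span_explicit by blast
      \<comment> \<open>Coefficients must be indexed by cosets; injectivity on \<open>?V\<close>
        recovers the representative.\<close>
      define c where "c b = d (the_inv_into ?V (tensor_class scale) b)" for b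
      have "c (tensor_class scale p) = d p" if "p \<in> S" for p
        unfolding c_def using that S(2) by (subst the_inv_into_f_f[OF inj]) (auto intro: formal.span_base)
      then have "t = (\<Oplus>\<^bsub>?T\<^esub>b\<in>tensor_class scale ` S. c b \<odot>\<^bsub>?T\<^esub> b)"
        using S(1,2) by (simp add: comb q(2) S(3))
      then show "t \<in> lin_span ?T (tensor_class scale ` ?B)"
        unfolding lin_span_def using S(1,2) by blast
    qed
  qed
  moreover have "tensor_class scale ` ?B \<subseteq> carrier ?T"
    by (auto simp: tensor_class_in_carrier)
  ultimately show ?thesis by (simp add: is_basis_def OSBB_words_eq[OF assms(4)])
qed

end
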